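(* Let $G$ be a finite group of order $v$ (not necessarily abelian) and let $D\subset G$ be a left difference set in $G$ with $|D|=k$ and parameters $(v,k,\lambda)$, where $k-\lambda>1$. Let $A(G,D)$ be the array with rows indexed by $D$, columns indexed by $G\setminus D$, and $(x,y)$ entry equal to $x^{-1}y$. Then $A(G,D)$ is a double array of size $k\times(v-k)$ on $v-1$ symbols. Moreover, $A(G,D)$ is a triple array if and only if the size of $x^{-1}D\cap D^{(-1)}y$ is constant over all $x\in D$ and $y\in G\setminus D$.
   Context: Groups are written multiplicatively. A $k$-subset $D$ of a group $G$ of order $v$ is a left difference set with parameters $(v,k,\lambda)$ if every non-identity element of $G$ can be written in exactly $\lambda$ ways as $x^{-1}y$ with $x,y\in D$. Notation: $D^{(-1)}=\{d^{-1}:d\in D\}$, $gD=\{gd:d\in D\}$, and $Dg=\{dg:d\in D\}$. A double array is an $r\times c$ array (every cell filled) on a set of symbols such that no symbol occurs more than once in any row or column, and for some constants $\kappa,\lambda_{rr},\lambda_{cc}$: (TA1) each symbol occurs exactly $\kappa$ times; (TA2) any two distinct rows contain exactly $\lambda_{rr}$ common symbols; (TA3) any two distinct columns contain exactly $\lambda_{cc}$ common symbols. A triple array is a double array which also satisfies, for some constant $\lambda_{rc}$: (TA4) any row and any column contain exactly $\lambda_{rc}$ common symbols. For $A(G,D)$ the symbol set is $G\setminus\{1\}$. *)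

theory Defs
  imports "HOL-Algebra.Coset"
begin

definition left_difference_set ::
    "('a, 'b) monoid_scheme \<Rightarrow> 'a set \<Rightarrow> nat \<Rightarrow> nat \<Rightarrow> nat \<Rightarrow> bool" where
  "left_difference_set G D v k l \<longleftrightarrow>
     finite (carrier G) \<and> order G = v \<and> D \<subseteq> carrier G \<and> card D = k \<and>
     (\<forall>g \<in> carrier G - {\<one>\<^bsub>G\<^esub>}.
        card {(x, y). x \<in> D \<and> y \<in> D \<and> inv\<^bsub>G\<^esub> x \<otimes>\<^bsub>G\<^esub> y = g} = l)"

(* Rows and columns are indexed by arbitrary finite sets R and C; the cell (x, y) contains A x y,
   and values of A outside R \<times> C are irrelevant.  Distinct cells of a row (column)
   contain distinct symbols, so the symbols of row x are A x ` C without repetition. *)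

definition double_array ::
    "'r set \<Rightarrow> 'c set \<Rightarrow> 's set \<Rightarrow> ('r \<Rightarrow> 'c \<Rightarrow> 's) \<Rightarrow> bool" where
  "double_array R C S A \<longleftrightarrow>
     finite R \<and> finite C \<and> finite S \<and>
     (\<forall>x\<in>R. \<forall>y\<in>C. A x y \<in> S) \<and>
     (\<forall>x\<in>R. inj_on (\<lambda>y. A x y) C) \<and>
     (\<forall>y\<in>C. inj_on (\<lambda>x. A x y) R) \<and>
     (\<exists>\<kappa>. \<forall>s\<in>S. card {(x, y). x \<in> R \<and> y \<in> C \<and> A x y = s} = \<kappa>) \<and>
     (\<exists>lrr. \<forall>x\<in>R. \<forall>x'\<in>R. x \<noteq> x' \<longrightarrow>
        card ((\<lambda>y. A x y) ` C \<inter> (\<lambda>y. A x' y) ` C) = lrr) \<and>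
     (\<exists>lcc. \<forall>y\<in>C. \<forall>y'\<in>C. y \<noteq> y' \<longrightarrow>
        card ((\<lambda>x. A x y) ` R \<inter> (\<lambda>x. A x y') ` R) = lcc)"

definition triple_array ::
    "'r set \<Rightarrow> 'c set \<Rightarrow> 's set \<Rightarrow> ('r \<Rightarrow> 'c \<Rightarrow> 's) \<Rightarrow> bool" where
  "triple_array R C S A \<longleftrightarrow>
     double_array R C S A \<and>
     (\<exists>lrc. \<forall>x\<in>R. \<forall>y\<in>C. card ((\<lambda>y'. A x y') ` C \<inter> (\<lambda>x'. A x' y) ` R) = lrc)"

definition quotient_array :: "('a, 'b) monoid_scheme \<Rightarrow> 'a \<Rightarrow> 'a \<Rightarrow> 'a" where
  "quotient_array G x y = inv\<^bsub>G\<^esub> x \<otimes>\<^bsub>G\<^esub> y"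

end

theory Submission
  imports Defs
begin

text \<open>
  Row \<open>x\<close> of the array carries the symbols \<open>G \ x\<inverse>D\<close> and column \<open>y\<close> carries \<open>D\<inverse>y\<close>, so two rows
  (or two columns) share a number of symbols governed by how often an element is of the form
  \<open>a b\<inverse>\<close> with \<open>a, b \<in> D\<close>, whereas the hypothesis concerns \<open>a\<inverse>b\<close>.  The two kinds of counts have
  the same sum, and the same sum of squares because \<open>a b\<inverse> = c d\<inverse>\<close> iff \<open>c\<inverse>a = d\<inverse>b\<close>, and the same
  value at the identity.  Hence their sums of squared deviations from \<open>\<lambda>\<close> over the non-identity
  elements agree; one of them vanishes, so both do, and a left difference set is also a right
  difference set.
\<close>

section \<open>Counting by fibres\<close>

lemma sum_card_fibres:
  assumes "finite P" "finite Q" "h ` P \<subseteq> Q"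
  shows "(\<Sum>g\<in>Q. card {p\<in>P. h p = g}) = card P"
proof -
  have "P = (\<Union>g\<in>Q. {p\<in>P. h p = g})"
    using assms(3) by auto
  moreover have "card (\<Union>g\<in>Q. {p\<in>P. h p = g}) = (\<Sum>g\<in>Q. card {p\<in>P. h p = g})"
    by (rule card_UN_disjoint) (use assms in auto)
  ultimately show ?thesis by simp
qed

text \<open>A fibre \<open>F\<close> of \<open>h\<close> contributes \<open>F \<times> F\<close>,
  the pairs on which \<open>h\<close> takes that one value. The right-hand side only records
  coincidences of \<open>h\<close>, so two different maps can be compared without knowing their
  fibres.\<close>

lemma sum_card_fibres_squared:
  assumes "finite P" "finite Q" "h ` P \<subseteq> Q"
  shows "(\<Sum>g\<in>Q. (card {p\<in>P. h p = g})\<^sup>2) = card {(p, q). p \<in> P \<and> q \<in> P \<and> h p = h q}"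
proof -
  have "{(p, q). p \<in> P \<and> q \<in> P \<and> h p = h q} = (\<Union>g\<in>Q. {p\<in>P. h p = g} \<times> {p\<in>P. h p = g})"
    using assms(3) by auto
  moreover have "card (\<Union>g\<in>Q. {p\<in>P. h p = g} \<times> {p\<in>P. h p = g})
      = (\<Sum>g\<in>Q. card ({p\<in>P. h p = g} \<times> {p\<in>P. h p = g}))"
    by (rule card_UN_disjoint) (use assms in auto)
  ultimately show ?thesis
    by (simp add: card_cartesian_product power2_eq_square)
qed

text \<open>By injectivity a common value arises from exactly one pair. This turns overlaps of
  translates into counts of representations as a quotient.\<close>

lemma card_image_Int_image:
  assumes "inj_on f A" "inj_on g A"
  shows "card (f ` A \<inter> g ` A) = card {p\<in>A \<times> A. f (fst p) = g (snd p)}"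
proof -
  have "f ` A \<inter> g ` A = (\<lambda>p. f (fst p)) ` {p\<in>A \<times> A. f (fst p) = g (snd p)}"
    by force
  moreover have "inj_on (\<lambda>p. f (fst p)) {p\<in>A \<times> A. f (fst p) = g (snd p)}"
    using assms by (fastforce simp: inj_on_def)
  ultimately show ?thesis
    by (simp only: card_image)
qed

section \<open>Left and right quotients in a group\<close>

context group
begin

text \<open>Both equations say \<open>a = c \<otimes> inv d \<otimes> b\<close>. This is the only
  bridge between quotients \<open>a \<otimes> inv b\<close> and quotients
  \<open>inv a \<otimes> b\<close>.\<close>

lemma mult_inv_eq_mult_inv_iff:
  assumes "a \<in> carrier G" "b \<in> carrier G" "c \<in> carrier G" "d \<in> carrier G"
  shows "a \<otimes> inv b = c \<otimes> inv d \<longleftrightarrow> inv c \<otimes> a = inv d \<otimes> b"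
proof -
  have "a \<otimes> inv b = c \<otimes> inv d \<longleftrightarrow> a = c \<otimes> (inv d \<otimes> b)"
    using assms by (metis inv_closed inv_solve_right m_assoc m_closed)
  also have "\<dots> \<longleftrightarrow> inv c \<otimes> a = inv d \<otimes> b"
    using assms by (metis inv_closed inv_solve_left m_closed)
  finally show ?thesis .
qed

lemma left_differences_constant_imp_right:
  assumes fin: "finite (carrier G)" and D: "D \<subseteq> carrier G"
    and left: "\<And>g. g \<in> carrier G - {\<one>} \<Longrightarrow> card {p\<in>D \<times> D. inv (fst p) \<otimes> snd p = g} = l"
    and g: "g \<in> carrier G - {\<one>}"
  shows "card {p\<in>D \<times> D. fst p \<otimes> inv (snd p) = g} = l"
proof -
  define f where "f g = card {p\<in>D \<times> D. inv (fst p) \<otimes> snd p = g}" for g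
  define f' where "f' g = card {p\<in>D \<times> D. fst p \<otimes> inv (snd p) = g}" for g
  have finP: "finite (D \<times> D)"
    using fin D finite_subset by blast
  have "(\<Sum>g\<in>carrier G. f g) = card (D \<times> D)" "(\<Sum>g\<in>carrier G. f' g) = card (D \<times> D)"
    unfolding f_def f'_def by (intro sum_card_fibres finP fin; use D in \<open>auto simp: subset_iff\<close>)+
  then have sum1: "(\<Sum>g\<in>carrier G. f' g) = (\<Sum>g\<in>carrier G. f g)" by simp
  let ?L = "{(p, q). p \<in> D \<times> D \<and> q \<in> D \<times> D \<and> inv (fst p) \<otimes> snd p = inv (fst q) \<otimes> snd q}"
  let ?R = "{(p, q). p \<in> D \<times> D \<and> q \<in> D \<times> D \<and> fst p \<otimes> inv (snd p) = fst q \<otimes> inv (snd q)}"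
  have "(\<Sum>g\<in>carrier G. (f g)\<^sup>2) = card ?L" "(\<Sum>g\<in>carrier G. (f' g)\<^sup>2) = card ?R"
    unfolding f_def f'_def
    by (intro sum_card_fibres_squared finP fin; use D in \<open>auto simp: subset_iff\<close>)+
  \<comment> \<open>Regrouping \<open>((a, b), (c, d))\<close> as \<open>((c, a), (d, b))\<close>
    matches coincidences of right quotients with coincidences of left quotients.\<close>
  moreover have "card ?R = card ?L"
    by (rule bij_betw_same_card[of "\<lambda>((a, b), (c, d)). ((c, a), (d, b))"],
        rule bij_betw_byWitness[where f' = "\<lambda>((c, a), (d, b)). ((a, b), (c, d))"])
      (use D mult_inv_eq_mult_inv_iff in \<open>auto simp: subset_iff\<close>)
  ultimately have sum2: "(\<Sum>g\<in>carrier G. (f' g)\<^sup>2) = (\<Sum>g\<in>carrier G. (f g)\<^sup>2)" by simp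
  \<comment> \<open>The assumption \<open>left\<close> does not cover the identity, but there both
    counts pick out the diagonal pairs.\<close>
  have "{p\<in>D \<times> D. inv (fst p) \<otimes> snd p = \<one>} = {p\<in>D \<times> D. fst p = snd p}"
    "{p\<in>D \<times> D. fst p \<otimes> inv (snd p) = \<one>} = {p\<in>D \<times> D. fst p = snd p}"
    using D by (auto simp: subset_iff inv_solve_left' inv_solve_right')
  then have one: "f' \<one> = f \<one>"
    by (simp add: f_def f'_def)
  \<comment> \<open>The right-hand side depends on \<open>h\<close> only through its sum, its sum of
    squares and \<open>h \<one>\<close>, which agree for \<open>f\<close> and \<open>f'\<close>.
    Integers are used because deviations from \<open>l\<close> may be negative.\<close>
  have expand: "(\<Sum>g\<in>carrier G - {\<one>}. (int (h g) - int l)\<^sup>2)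
      = int (\<Sum>g\<in>carrier G. (h g)\<^sup>2) - 2 * int l * int (\<Sum>g\<in>carrier G. h g)
        + int (card (carrier G)) * (int l)\<^sup>2 - (int (h \<one>) - int l)\<^sup>2" for h
  proof -
    have "(\<Sum>g\<in>carrier G. (int (h g) - int l)\<^sup>2)
        = int (\<Sum>g\<in>carrier G. (h g)\<^sup>2) - 2 * int l * int (\<Sum>g\<in>carrier G. h g)
          + int (card (carrier G)) * (int l)\<^sup>2"
      by (simp add: power2_diff sum.distrib sum_subtractf sum_distrib_left mult_ac)
    then show ?thesis
      using fin by (simp only: sum_diff1 one_closed if_True)
  qed
  have "(\<Sum>g\<in>carrier G - {\<one>}. (int (f' g) - int l)\<^sup>2) = (\<Sum>g\<in>carrier G - {\<one>}. (int (f g) - int l)\<^sup>2)"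
    by (simp only: expand sum1 sum2 one)
  also have "\<dots> = 0"
    using left by (simp add: f_def)
  finally have "\<forall>g\<in>carrier G - {\<one>}. (int (f' g) - int l)\<^sup>2 = 0"
    using fin by (subst (asm) sum_nonneg_eq_0_iff) auto
  then show ?thesis
    using g by (simp add: f'_def)
qed

section \<open>Translates of a subset, the symbol sets of rows and columns\<close>

lemma l_coset_eq_image: "g <# D = (\<lambda>d. g \<otimes> d) ` D"
  by (auto simp: l_coset_def)

lemma set_inv_r_coset_eq_image: "set_inv D #> g = (\<lambda>d. inv d \<otimes> g) ` D"
  by (auto simp: r_coset_def SET_INV_def)

lemma inj_on_mult_left: "x \<in> carrier G \<Longrightarrow> D \<subseteq> carrier G \<Longrightarrow> inj_on (\<lambda>d. x \<otimes> d) D"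
  by (auto simp: inj_on_def subset_iff)

lemma inj_on_inv_mult: "x \<in> carrier G \<Longrightarrow> D \<subseteq> carrier G \<Longrightarrow> inj_on (\<lambda>d. inv d \<otimes> x) D"
  by (auto simp: inj_on_def subset_iff) (metis inv_inv)

lemma image_mult_Compl:
  assumes "x \<in> carrier G" "D \<subseteq> carrier G"
  shows "(\<lambda>d. x \<otimes> d) ` (carrier G - D) = carrier G - (\<lambda>d. x \<otimes> d) ` D"
proof -
  have "(\<lambda>d. x \<otimes> d) ` carrier G = carrier G"
    using assms(1) surj_const_mult by blast
  then show ?thesis
    using assms inj_on_image_set_diff[OF inj_on_mult_left[OF assms(1) subset_refl], of "carrier G" D]
    by auto
qed

text \<open>A common element \<open>inv x \<otimes> a = inv x' \<otimes> b\<close> amounts to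
  \<open>a \<otimes> inv b = x \<otimes> inv x'\<close>. Right quotients appear, which is why the
  left difference property alone does not give the row overlaps directly.\<close>

lemma card_l_translates_Int:
  assumes "x \<in> carrier G" "x' \<in> carrier G" "D \<subseteq> carrier G"
  shows "card ((\<lambda>d. inv x \<otimes> d) ` D \<inter> (\<lambda>d. inv x' \<otimes> d) ` D)
    = card {p\<in>D \<times> D. fst p \<otimes> inv (snd p) = x \<otimes> inv x'}"
proof -
  have "a \<otimes> inv b = x \<otimes> inv x' \<longleftrightarrow> inv x \<otimes> a = inv x' \<otimes> b" if "a \<in> D" "b \<in> D" for a b
    using that assms by (intro mult_inv_eq_mult_inv_iff) auto
  then have "{p\<in>D \<times> D. fst p \<otimes> inv (snd p) = x \<otimes> inv x'}
      = {p\<in>D \<times> D. inv x \<otimes> fst p = inv x' \<otimes> snd p}"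
    by auto
  then show ?thesis
    using assms by (simp add: card_image_Int_image inj_on_mult_left)
qed

lemma card_r_translates_Int:
  assumes "y \<in> carrier G" "y' \<in> carrier G" "D \<subseteq> carrier G"
  shows "card ((\<lambda>d. inv d \<otimes> y) ` D \<inter> (\<lambda>d. inv d \<otimes> y') ` D)
    = card {p\<in>D \<times> D. fst p \<otimes> inv (snd p) = y \<otimes> inv y'}"
proof -
  have "a \<otimes> inv b = y \<otimes> inv y' \<longleftrightarrow> inv a \<otimes> y = inv b \<otimes> y'" if "a \<in> D" "b \<in> D" for a b
    using mult_inv_eq_mult_inv_iff[of y y' a b] that assms by (auto simp: subset_iff)
  then have "{p\<in>D \<times> D. fst p \<otimes> inv (snd p) = y \<otimes> inv y'}
      = {p\<in>D \<times> D. inv (fst p) \<otimes> y = inv (snd p) \<otimes> y'}"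
    by auto
  then show ?thesis
    using assms by (simp add: card_image_Int_image inj_on_inv_mult)
qed

text \<open>Given \<open>s\<close>, the element \<open>x\<close> forces
  \<open>y = x \<otimes> s\<close>, so \<open>D\<close> splits according to whether
  \<open>x \<otimes> s\<close> falls inside or outside \<open>D\<close>.\<close>

lemma card_quotient_eq_Compl:
  assumes "finite D" "D \<subseteq> carrier G" "s \<in> carrier G"
  shows "card {(x, y). x \<in> D \<and> y \<in> carrier G - D \<and> inv x \<otimes> y = s}
    = card D - card {p\<in>D \<times> D. inv (fst p) \<otimes> snd p = s}"
proof -
  let ?U = "{(x, y). x \<in> D \<and> y \<in> carrier G - D \<and> inv x \<otimes> y = s}"
  let ?V = "{p\<in>D \<times> D. inv (fst p) \<otimes> snd p = s}"
  have eq: "inv x \<otimes> y = s \<longleftrightarrow> y = x \<otimes> s" if "x \<in> D" "y \<in> carrier G" for x y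
    using that assms inv_solve_left' by (auto simp: subset_iff)
  have "?U = {(x, y). x \<in> D \<and> y \<in> carrier G - D \<and> y = x \<otimes> s}"
    using eq by blast
  also have "\<dots> = (\<lambda>x. (x, x \<otimes> s)) ` {x\<in>D. x \<otimes> s \<notin> D}"
    using assms by auto
  finally have U: "?U = (\<lambda>x. (x, x \<otimes> s)) ` {x\<in>D. x \<otimes> s \<notin> D}" .
  have "?V = {(x, y). x \<in> D \<and> y \<in> D \<and> inv x \<otimes> y = s}"
    by auto
  also have "\<dots> = {(x, y). x \<in> D \<and> y \<in> D \<and> y = x \<otimes> s}"
    using eq assms(2) by blast
  also have "\<dots> = (\<lambda>x. (x, x \<otimes> s)) ` {x\<in>D. x \<otimes> s \<in> D}"
    by auto
  finally have V: "?V = (\<lambda>x. (x, x \<otimes> s)) ` {x\<in>D. x \<otimes> s \<in> D}" .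
  have "inj_on (\<lambda>x. (x, x \<otimes> s)) A" for A
    by (auto simp: inj_on_def)
  then have card: "card ?U = card {x\<in>D. x \<otimes> s \<notin> D}" "card ?V = card {x\<in>D. x \<otimes> s \<in> D}"
    by (simp_all only: U V card_image)
  have "{x\<in>D. x \<otimes> s \<notin> D} = D - {x\<in>D. x \<otimes> s \<in> D}" by auto
  then have "card {x\<in>D. x \<otimes> s \<notin> D} = card D - card {x\<in>D. x \<otimes> s \<in> D}"
    using assms(1) by (simp add: card_Diff_subset)
  then show ?thesis
    by (simp only: card)
qed

end

section \<open>The double array and the criterion for a triple array\<close>

theorem proposition5p2:
  fixes G :: "('a, 'b) monoid_scheme" and D :: "'a set" and v k l :: nat
  assumes "group G" and "finite (carrier G)"
    and "left_difference_set G D v k l"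
    and "k - l > 1"
  shows "double_array D (carrier G - D) (carrier G - {\<one>\<^bsub>G\<^esub>}) (quotient_array G)
      \<and> card D = k \<and> card (carrier G - D) = v - k \<and> card (carrier G - {\<one>\<^bsub>G\<^esub>}) = v - 1
      \<and> (triple_array D (carrier G - D) (carrier G - {\<one>\<^bsub>G\<^esub>}) (quotient_array G) \<longleftrightarrow>
           (\<exists>c. \<forall>x\<in>D. \<forall>y\<in>carrier G - D.
              card ((inv\<^bsub>G\<^esub> x <#\<^bsub>G\<^esub> D) \<inter> (set_inv\<^bsub>G\<^esub> D #>\<^bsub>G\<^esub> y)) = c))"
proof -
  interpret group G by fact
  have fin: "finite (carrier G)" by fact
  from assms(3) have D: "D \<subseteq> carrier G" and k: "card D = k" and v: "card (carrier G) = v"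
    and l: "\<And>g. g \<in> carrier G - {\<one>\<^bsub>G\<^esub>} \<Longrightarrow>
      card {(x, y). x \<in> D \<and> y \<in> D \<and> inv\<^bsub>G\<^esub> x \<otimes>\<^bsub>G\<^esub> y = g} = l"
    by (auto simp: left_difference_set_def order_def)
  have finD: "finite D" using D fin finite_subset by blast
  have "{(x, y). x \<in> D \<and> y \<in> D \<and> inv\<^bsub>G\<^esub> x \<otimes>\<^bsub>G\<^esub> y = g}
      = {p\<in>D \<times> D. inv\<^bsub>G\<^esub> (fst p) \<otimes>\<^bsub>G\<^esub> snd p = g}" for g
    by auto
  then have left: "card {p\<in>D \<times> D. inv\<^bsub>G\<^esub> (fst p) \<otimes>\<^bsub>G\<^esub> snd p = g} = l"
    if "g \<in> carrier G - {\<one>\<^bsub>G\<^esub>}" for g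
    using l[OF that] by simp
  have right: "card {p\<in>D \<times> D. fst p \<otimes>\<^bsub>G\<^esub> inv\<^bsub>G\<^esub> (snd p) = g} = l"
    if "g \<in> carrier G - {\<one>\<^bsub>G\<^esub>}" for g
    using fin D left that by (rule left_differences_constant_imp_right)
  have ne: "x \<otimes>\<^bsub>G\<^esub> inv\<^bsub>G\<^esub> x' \<in> carrier G - {\<one>\<^bsub>G\<^esub>}"
    if "x \<in> carrier G" "x' \<in> carrier G" "x \<noteq> x'" for x x'
    using that by (simp add: inv_solve_right')
  have entry: "inv\<^bsub>G\<^esub> x \<otimes>\<^bsub>G\<^esub> y \<in> carrier G - {\<one>\<^bsub>G\<^esub>}" if "x \<in> D" "y \<in> carrier G - D" for x y
  proof -
    \<comment> \<open>Row and column indices come from disjoint sets, so the identity never occurs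
      as an entry.\<close>
    have "x \<in> carrier G" "x \<noteq> y" using that D by auto
    then show ?thesis using that by (simp add: inv_solve_left')
  qed
  have row: "(\<lambda>y. inv\<^bsub>G\<^esub> x \<otimes>\<^bsub>G\<^esub> y) ` (carrier G - D) = carrier G - (\<lambda>y. inv\<^bsub>G\<^esub> x \<otimes>\<^bsub>G\<^esub> y) ` D"
    if "x \<in> D" for x
    using that D by (intro image_mult_Compl) auto
  \<comment> \<open>Each row is the complement of a translate of \<open>D\<close>, so two rows share
    the complement of a union, whose size \<open>2 * k - l\<close> comes from
    inclusion-exclusion.\<close>
  have rows: "card ((\<lambda>y. inv\<^bsub>G\<^esub> x \<otimes>\<^bsub>G\<^esub> y) ` (carrier G - D) \<inter> (\<lambda>y. inv\<^bsub>G\<^esub> x' \<otimes>\<^bsub>G\<^esub> y) ` (carrier G - D))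
      = v - (2 * k - l)" if xs: "x \<in> D" "x' \<in> D" "x \<noteq> x'" for x x'
  proof -
    let ?X = "(\<lambda>y. inv\<^bsub>G\<^esub> x \<otimes>\<^bsub>G\<^esub> y) ` D" and ?X' = "(\<lambda>y. inv\<^bsub>G\<^esub> x' \<otimes>\<^bsub>G\<^esub> y) ` D"
    have xG: "x \<in> carrier G" "x' \<in> carrier G" using xs D by auto
    have "card ?X = k" "card ?X' = k"
      using xG D k by (simp_all add: card_image inj_on_mult_left)
    moreover have "card (?X \<inter> ?X') = l"
      using card_l_translates_Int[OF xG D] right[OF ne[OF xG xs(3)]] by simp
    ultimately have "card (?X \<union> ?X') = 2 * k - l"
      using card_Un_Int[of ?X ?X'] finD by simp
    moreover have "?X \<union> ?X' \<subseteq> carrier G" using xG D by auto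
    moreover have "(carrier G - ?X) \<inter> (carrier G - ?X') = carrier G - (?X \<union> ?X')" by auto
    ultimately show ?thesis
      using xs finD v by (simp add: row card_Diff_subset)
  qed
  have cols: "card ((\<lambda>x. inv\<^bsub>G\<^esub> x \<otimes>\<^bsub>G\<^esub> y) ` D \<inter> (\<lambda>x. inv\<^bsub>G\<^esub> x \<otimes>\<^bsub>G\<^esub> y') ` D) = l"
    if "y \<in> carrier G - D" "y' \<in> carrier G - D" "y \<noteq> y'" for y y'
    using that card_r_translates_Int[of y y' D] right[OF ne[of y y']] D by simp
  have occ: "card {(x, y). x \<in> D \<and> y \<in> carrier G - D \<and> inv\<^bsub>G\<^esub> x \<otimes>\<^bsub>G\<^esub> y = s} = k - l"
    if "s \<in> carrier G - {\<one>\<^bsub>G\<^esub>}" for s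
    using that finD D k by (simp only: card_quotient_eq_Compl left DiffD1)
  have inj_row: "inj_on (\<lambda>y. inv\<^bsub>G\<^esub> x \<otimes>\<^bsub>G\<^esub> y) (carrier G - D)" if "x \<in> D" for x
    using that D by (intro inj_on_mult_left) auto
  have inj_col: "inj_on (\<lambda>x. inv\<^bsub>G\<^esub> x \<otimes>\<^bsub>G\<^esub> y) D" if "y \<in> carrier G - D" for y
    using that D by (intro inj_on_inv_mult) auto
  have double: "double_array D (carrier G - D) (carrier G - {\<one>\<^bsub>G\<^esub>}) (quotient_array G)"
    unfolding double_array_def quotient_array_def
    by (intro conjI exI ballI impI;
        (rule fin finD finite_Diff[OF fin] entry rows cols occ inj_row inj_col; assumption))
  \<comment> \<open>The \<open>k\<close> symbols of column \<open>y\<close> split into those in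
    \<open>inv x \<otimes> D\<close> and those outside it; the latter are exactly the ones shared
    with row \<open>x\<close>. Hence one of the two sizes is constant iff the other is, and stating
    a sum avoids truncated subtraction.\<close>
  have mixed: "card ((\<lambda>y'. inv\<^bsub>G\<^esub> x \<otimes>\<^bsub>G\<^esub> y') ` (carrier G - D) \<inter> (\<lambda>x'. inv\<^bsub>G\<^esub> x' \<otimes>\<^bsub>G\<^esub> y) ` D)
      + card ((inv\<^bsub>G\<^esub> x <#\<^bsub>G\<^esub> D) \<inter> (set_inv\<^bsub>G\<^esub> D #>\<^bsub>G\<^esub> y)) = k"
    if xy: "x \<in> D" "y \<in> carrier G - D" for x y
  proof -
    let ?X = "(\<lambda>d. inv\<^bsub>G\<^esub> x \<otimes>\<^bsub>G\<^esub> d) ` D" and ?Y = "(\<lambda>d. inv\<^bsub>G\<^esub> d \<otimes>\<^bsub>G\<^esub> y) ` D"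
    have "?Y \<subseteq> carrier G" using xy D by auto
    then have "(carrier G - ?X) \<inter> ?Y = ?Y - ?X" by auto
    moreover have "card (?Y - ?X) + card (?X \<inter> ?Y) = card ?Y"
      using finD card_Int_Diff[of ?Y ?X] by (simp add: Int_commute)
    moreover have "card ?Y = k"
      using xy D k by (simp add: card_image inj_on_inv_mult)
    ultimately show ?thesis
      using xy by (simp add: row l_coset_eq_image set_inv_r_coset_eq_image)
  qed
  have "triple_array D (carrier G - D) (carrier G - {\<one>\<^bsub>G\<^esub>}) (quotient_array G) \<longleftrightarrow>
    (\<exists>c. \<forall>x\<in>D. \<forall>y\<in>carrier G - D.
      card ((inv\<^bsub>G\<^esub> x <#\<^bsub>G\<^esub> D) \<inter> (set_inv\<^bsub>G\<^esub> D #>\<^bsub>G\<^esub> y)) = c)"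
    (is "?triple \<longleftrightarrow> (\<exists>c. \<forall>x\<in>D. \<forall>y\<in>carrier G - D. ?n x y = c)")
  proof
    assume ?triple
    then obtain lrc where lrc: "\<And>x y. x \<in> D \<Longrightarrow> y \<in> carrier G - D \<Longrightarrow>
        card ((\<lambda>y'. inv\<^bsub>G\<^esub> x \<otimes>\<^bsub>G\<^esub> y') ` (carrier G - D) \<inter> (\<lambda>x'. inv\<^bsub>G\<^esub> x' \<otimes>\<^bsub>G\<^esub> y) ` D) = lrc"
      unfolding triple_array_def quotient_array_def by blast
    have "?n x y = k - lrc" if "x \<in> D" "y \<in> carrier G - D" for x y
      using mixed[OF that] lrc[OF that] by linarith
    then show "\<exists>c. \<forall>x\<in>D. \<forall>y\<in>carrier G - D. ?n x y = c" by blast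
  next
    assume "\<exists>c. \<forall>x\<in>D. \<forall>y\<in>carrier G - D. ?n x y = c"
    then obtain c where c: "\<And>x y. x \<in> D \<Longrightarrow> y \<in> carrier G - D \<Longrightarrow> ?n x y = c" by blast
    have "card ((\<lambda>y'. inv\<^bsub>G\<^esub> x \<otimes>\<^bsub>G\<^esub> y') ` (carrier G - D) \<inter> (\<lambda>x'. inv\<^bsub>G\<^esub> x' \<otimes>\<^bsub>G\<^esub> y) ` D) = k - c"
      if "x \<in> D" "y \<in> carrier G - D" for x y
      using mixed[OF that] c[OF that] by linarith
    then show ?triple
      using double unfolding triple_array_def quotient_array_def by blast
  qed
  then show ?thesis
    using double k v D fin finD by (simp add: card_Diff_subset)
qed

end
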